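(* Let $N\ge2$, $d\ge1$, and let $f_{ij}=f_{ji}\in\mathbb R$ for $i\ne j$ in $\{1,\dots,N\}$. The following statements are equivalent. (i) There exist at least one $y\in\mathcal S^\circ$ and real numbers $\kappa_i(y)$ such that $$\mathcal D_y^{\mathrm{fr}}(u)=\sum_{i=1}^Ny_i\kappa_i(y)|u_i|^2\qquad\text{for every }u\in E_y^{(d)}.$$ (ii) For every $y\in\mathcal S^\circ$ there are real numbers $\kappa_i(y)$ such that this identity holds for every $u\in E_y^{(d)}$. (iii) There exist real numbers $g_1,\dots,g_N$ such that $f_{ij}=g_i+g_j$ for all $i\ne j$. If these equivalent conditions hold and $s:=\sum_ig_iy_i$, then one may take $\kappa_i(y)=g_i+s$, i.e. $\mathcal D_y^{\mathrm{fr}}(u)=\sum_{i=1}^Ny_i(g_i+s)|u_i|^2$ for $u\in E_y^{(d)}$. For $N\ge3$ the vector $g$ is unique and is recovered from any three distinct indices $i,j,k$ by $g_i=\frac12(f_{ij}+f_{ik}-f_{jk})$. Moreover, under (iii), define for $y\in\mathcal S^\circ$ the linear operator $\mathcal L_y$ by $(\mathcal L_yu)_i:=\sum_{j=1}^N(g_i+g_j)y_j(u_i-u_j)$. Then, for $u\in E_y^{(d)}$, $$(\mathcal L_yu)_i=(g_i+s)u_i-\mathfrak m_y(u),\qquad \mathfrak m_y(u):=\sum_{j=1}^Ng_jy_ju_j,\qquad\text{and}\qquad \mathcal D_y^{\mathrm{fr}}(u)=\langle\mathcal L_yu,u\rangle_y.$$ If $Y=\operatorname{diag}(y_1,\dots,y_N)$,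 then the Maxwell--Stefan matrix $B(y)$ satisfies $B(y)Y=-Y\mathcal L_y$.
   Context: $\mathcal S^\circ=\{y\in(0,1)^N:\sum_iy_i=1\}$. For $y\in\mathcal S^\circ$: $E_y^{(d)}=\{u=(u_1,\dots,u_N)\in(\mathbb R^d)^N:\sum_iy_iu_i=0\}$, $\langle u,v\rangle_y=\sum_iy_iu_i\cdot v_i$, and the Rayleigh (pair-friction) dissipation is $\mathcal D_y^{\mathrm{fr}}(u)=\frac12\sum_{i\ne j}f_{ij}y_iy_j|u_i-u_j|^2$ (sum over ordered pairs). The Maxwell--Stefan matrix $B(y)\in\mathbb R^{N\times N}$ is $B_{ij}(y)=y_if_{ij}$ for $i\ne j$ and $B_{ii}(y)=-\sum_{\ell\ne i}f_{i\ell}y_\ell$. In the identity $B(y)Y=-Y\mathcal L_y$ the operator $\mathcal L_y$ is regarded as an operator (matrix) on $\mathbb R^N$ ($d=1$), by the same defining formula. *)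

theory Defs
  imports "HOL-Analysis.Analysis"
begin

text \<open>
  The index set of the N species is a finite type \<open>'n\<close>, so N is \<open>CARD('n)\<close>; \<open>(\<real>\<^sup>d)\<^sup>N\<close> is
  \<open>(real^'d)^'n\<close>. The friction coefficients are a function \<open>f\<close> of two indices whose diagonal values
  \<open>f i i\<close> carry no meaning: no definition below refers to them.
\<close>

definition open_simplex :: "(real^'n::finite) set" where
  "open_simplex = {y. (\<forall>i. 0 < y $ i \<and> y $ i < 1) \<and> (\<Sum>i\<in>UNIV. y $ i) = 1}"

definition E_space :: "real^'n::finite \<Rightarrow> ((real^'d::finite)^'n) set" where
  "E_space y = {u. (\<Sum>i\<in>UNIV. (y $ i) *\<^sub>R (u $ i)) = 0}"

definition inner_y :: "real^'n::finite \<Rightarrow> (real^'d::finite)^'n \<Rightarrow> (real^'d)^'n \<Rightarrow> real" where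
  "inner_y y u v = (\<Sum>i\<in>UNIV. y $ i * ((u $ i) \<bullet> (v $ i)))"

definition friction_dissipation ::
  "('n::finite \<Rightarrow> 'n \<Rightarrow> real) \<Rightarrow> real^'n \<Rightarrow> (real^'d::finite)^'n \<Rightarrow> real" where
  "friction_dissipation f y u =
     1/2 * (\<Sum>i\<in>UNIV. \<Sum>j\<in>UNIV - {i}. f i j * y $ i * y $ j * (norm (u $ i - u $ j))\<^sup>2)"

definition MS_matrix :: "('n::finite \<Rightarrow> 'n \<Rightarrow> real) \<Rightarrow> real^'n \<Rightarrow> real^'n^'n" where
  "MS_matrix f y =
     (\<chi> i j. if i = j then - (\<Sum>l\<in>UNIV - {i}. f i l * y $ l) else y $ i * f i j)"

definition additive_friction :: "('n::finite \<Rightarrow> 'n \<Rightarrow> real) \<Rightarrow> real^'n \<Rightarrow> bool" where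
  "additive_friction f g \<longleftrightarrow> (\<forall>i j. i \<noteq> j \<longrightarrow> f i j = g $ i + g $ j)"

definition diagonal_form_on_E ::
  "'d::finite itself \<Rightarrow> ('n::finite \<Rightarrow> 'n \<Rightarrow> real) \<Rightarrow> real^'n \<Rightarrow> ('n \<Rightarrow> real) \<Rightarrow> bool" where
  "diagonal_form_on_E _ f y \<kappa> \<longleftrightarrow>
     (\<forall>u \<in> (E_space y :: ((real^'d)^'n) set).
        friction_dissipation f y u = (\<Sum>i\<in>UNIV. y $ i * \<kappa> i * (norm (u $ i))\<^sup>2))"

text \<open>
  One formula serves both for \<open>'a = real^'d\<close> and for \<open>'a = real\<close>; the latter gives the operator on
  \<open>\<real>\<^sup>N\<close> whose matrix is compared with the Maxwell--Stefan matrix.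
\<close>

definition L_op :: "real^'n::finite \<Rightarrow> real^'n \<Rightarrow> ('a::real_normed_vector)^'n \<Rightarrow> 'a^'n" where
  "L_op g y u = (\<chi> i. \<Sum>j\<in>UNIV. ((g $ i + g $ j) * y $ j) *\<^sub>R (u $ i - u $ j))"

definition m_avg :: "real^'n::finite \<Rightarrow> real^'n \<Rightarrow> (real^'d::finite)^'n \<Rightarrow> real^'d" where
  "m_avg g y u = (\<Sum>j\<in>UNIV. (g $ j * y $ j) *\<^sub>R (u $ j))"

definition diag_matrix :: "real^'n::finite \<Rightarrow> real^'n^'n" where
  "diag_matrix y = (\<chi> i j. if i = j then y $ i else 0)"

end

(*
  Substituting x_i = y_i u_i turns the difference of the two quadratic forms into
  the sum of a_i x_i^2 minus the sum of f_ij x_i . x_j, on the hyperplane where the x_i sum to 0.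
  Evaluating it at x = e_i - e_j already yields the additive form of f; conversely, for
  f_ij = g_i + g_j the mixed term factors through the sum of y_j u_j, which vanishes on E_y.
*)

theory Submission
  imports Defs
begin

text \<open>The added terms \<open>j = i\<close> vanish because \<open>u $ i - u $ i = 0\<close>,
  whatever \<open>f i i\<close> is. Sums over all pairs can then be swapped and factored
  freely.\<close>

lemma friction_dissipation_full_sum:
  "friction_dissipation f y u =
     1/2 * (\<Sum>i\<in>UNIV. \<Sum>j\<in>UNIV. f i j * y $ i * y $ j * (norm (u $ i - u $ j))\<^sup>2)"
proof -
  have "(\<Sum>j\<in>UNIV - {i}. f i j * y $ i * y $ j * (norm (u $ i - u $ j))\<^sup>2)
      = (\<Sum>j\<in>UNIV. f i j * y $ i * y $ j * (norm (u $ i - u $ j))\<^sup>2)" for i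
    by (rule sum.mono_neutral_left) auto
  then show ?thesis
    by (simp add: friction_dissipation_def)
qed

text \<open>Polarisation of the squared norms, where symmetry of \<open>f\<close> makes the two
  square terms contribute equally. The arbitrary values \<open>f i i\<close> enter both sums on the
  right with the same term and cancel.\<close>

lemma friction_dissipation_expand:
  fixes f :: "'n::finite \<Rightarrow> 'n \<Rightarrow> real"
  assumes sym: "\<And>i j. i \<noteq> j \<Longrightarrow> f i j = f j i"
  shows "friction_dissipation f y u =
     (\<Sum>i\<in>UNIV. y $ i * (\<Sum>j\<in>UNIV. f i j * y $ j) * (norm (u $ i))\<^sup>2)
     - (\<Sum>i\<in>UNIV. \<Sum>j\<in>UNIV. f i j * y $ i * y $ j * (u $ i \<bullet> u $ j))"
proof -
  define A where "A i j = f i j * y $ i * y $ j * (norm (u $ i))\<^sup>2" for i j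
  define C where "C i j = f i j * y $ i * y $ j * (u $ i \<bullet> u $ j)" for i j
  have sym': "f i j = f j i" for i j
    using sym by (cases "i = j") auto
  have "f i j * y $ i * y $ j * (norm (u $ i - u $ j))\<^sup>2 = A i j + A j i - 2 * C i j" for i j
    using sym'[of j i]
    by (simp add: A_def C_def power2_norm_eq_inner inner_diff inner_commute algebra_simps)
  then have "friction_dissipation f y u
      = 1/2 * ((\<Sum>i\<in>UNIV. \<Sum>j\<in>UNIV. A i j) + (\<Sum>i\<in>UNIV. \<Sum>j\<in>UNIV. A j i)
          - 2 * (\<Sum>i\<in>UNIV. \<Sum>j\<in>UNIV. C i j))"
    by (simp add: friction_dissipation_full_sum sum.distrib sum_subtractf sum_distrib_left)
  also have "(\<Sum>i\<in>UNIV. \<Sum>j\<in>UNIV. A j i) = (\<Sum>i\<in>UNIV. \<Sum>j\<in>UNIV. A i j)"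
    by (rule sum.swap)
  finally have "friction_dissipation f y u
      = (\<Sum>i\<in>UNIV. \<Sum>j\<in>UNIV. A i j) - (\<Sum>i\<in>UNIV. \<Sum>j\<in>UNIV. C i j)"
    by simp
  moreover have "(\<Sum>j\<in>UNIV. A i j) = y $ i * (\<Sum>j\<in>UNIV. f i j * y $ j) * (norm (u $ i))\<^sup>2" for i
    by (simp add: A_def sum_distrib_left sum_distrib_right mult_ac)
  ultimately show ?thesis
    by (simp add: C_def)
qed

text \<open>Lets the weights \<open>g $ i + g $ j\<close> be used on the diagonal too, where
  \<open>f\<close> itself is unconstrained.\<close>

lemma friction_dissipation_additive:
  assumes "additive_friction f g"
  shows "friction_dissipation f y u = friction_dissipation (\<lambda>i j. g $ i + g $ j) y u"
  using assms by (auto simp: friction_dissipation_def additive_friction_def intro!: sum.cong)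

lemma sum_additive_weights:
  fixes g y :: "real^'n::finite"
  assumes "y \<in> open_simplex"
  shows "(\<Sum>j\<in>UNIV. (g $ i + g $ j) * y $ j) = g $ i + (\<Sum>j\<in>UNIV. g $ j * y $ j)"
proof -
  have "(\<Sum>j\<in>UNIV. y $ j) = 1"
    using assms by (simp add: open_simplex_def)
  then show ?thesis
    by (simp add: distrib_right sum.distrib flip: sum_distrib_left)
qed

text \<open>In the expansion, the square terms carry the row sums of the weights, which give the
  coefficients \<open>g $ i + s\<close>. The mixed sum splits into two products, each with the
  factor \<open>p\<close>, and \<open>p = 0\<close> on \<open>E_space y\<close>.\<close>

lemma additive_imp_diagonal_form:
  fixes f :: "'n::finite \<Rightarrow> 'n \<Rightarrow> real"
  assumes g: "additive_friction f g" and y: "y \<in> open_simplex"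
  shows "diagonal_form_on_E TYPE('d::finite) f y (\<lambda>i. g $ i + (\<Sum>j\<in>UNIV. g $ j * y $ j))"
  unfolding diagonal_form_on_E_def
proof
  fix u :: "(real^'d)^'n" assume u: "u \<in> E_space y"
  define p where "p = (\<Sum>i\<in>UNIV. y $ i *\<^sub>R u $ i)"
  define q where "q = (\<Sum>i\<in>UNIV. (g $ i * y $ i) *\<^sub>R u $ i)"
  have p0: "p = 0"
    using u by (simp add: p_def E_space_def)
  \<comment> \<open>Unfolding in two stages makes the left factor supply the outer sum, so the order
    of summation matches without a swap; likewise for \<open>pq\<close>.\<close>
  have qp: "(\<Sum>i\<in>UNIV. \<Sum>j\<in>UNIV. (g $ i * y $ i * y $ j) * (u $ i \<bullet> u $ j)) = q \<bullet> p"
    unfolding q_def inner_sum_left unfolding p_def inner_sum_right by (simp add: mult_ac)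
  have pq: "(\<Sum>i\<in>UNIV. \<Sum>j\<in>UNIV. (g $ j * y $ i * y $ j) * (u $ i \<bullet> u $ j)) = p \<bullet> q"
    unfolding p_def inner_sum_left unfolding q_def inner_sum_right by (simp add: mult_ac)
  have "(\<Sum>i\<in>UNIV. \<Sum>j\<in>UNIV. (g $ i + g $ j) * y $ i * y $ j * (u $ i \<bullet> u $ j)) = q \<bullet> p + p \<bullet> q"
    by (simp add: distrib_right sum.distrib flip: qp pq)
  then have "(\<Sum>i\<in>UNIV. \<Sum>j\<in>UNIV. (g $ i + g $ j) * y $ i * y $ j * (u $ i \<bullet> u $ j)) = 0"
    by (simp add: p0)
  then show "friction_dissipation f y u =
      (\<Sum>i\<in>UNIV. y $ i * (g $ i + (\<Sum>j\<in>UNIV. g $ j * y $ j)) * (norm (u $ i))\<^sup>2)"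
    using friction_dissipation_expand[of "\<lambda>i j. g $ i + g $ j" y u]
    by (simp add: friction_dissipation_additive[OF g] sum_additive_weights[OF y] add.commute)
qed

text \<open>The identity at one single \<open>y\<close> suffices: for each pair it is tested on one
  vector, for which the quadratic form involves only the indices \<open>i\<close> and
  \<open>j\<close>.\<close>

lemma diagonal_form_imp_additive:
  fixes f :: "'n::finite \<Rightarrow> 'n \<Rightarrow> real"
  assumes sym: "\<And>i j. i \<noteq> j \<Longrightarrow> f i j = f j i"
    and y: "y \<in> open_simplex"
    and diag: "diagonal_form_on_E TYPE('d::finite) f y \<kappa>"
  shows "\<exists>g. additive_friction f g"
proof -
  have pos: "y $ i > 0" for i
    using y by (simp add: open_simplex_def)
  \<comment> \<open>The coefficient of the square of \<open>x i\<close> once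
    \<open>x i = y $ i * u $ i\<close> is substituted. It has the form \<open>f i i\<close> plus
    terms free of \<open>f i i\<close>, so the witness \<open>(f i i - a i) / 2\<close> does not
    depend on the meaningless diagonal.\<close>
  define a where "a i = ((\<Sum>j\<in>UNIV. f i j * y $ j) - \<kappa> i) / y $ i" for i
  have "f i j = (f i i - a i) / 2 + (f j j - a j) / 2" if "i \<noteq> j" for i j
  proof -
    fix k :: 'd
    define x where "x l = (if l = i then 1 else 0) - (if l = j then 1 else (0::real))" for l
    define e :: "real^'d" where "e = axis k 1"
    \<comment> \<open>Chosen so that \<open>y $ l *\<^sub>R u $ l = x l *\<^sub>R e\<close>; the
      entries of \<open>x\<close> sum to 0, which puts \<open>u\<close> in \<open>E_space y\<close>.
      The unit vector \<open>e\<close> reduces the vector problem to a scalar one.\<close>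
    define u :: "(real^'d)^'n" where "u = (\<chi> l. (x l / y $ l) *\<^sub>R e)"
    have e: "e \<bullet> e = 1"
      by (simp add: e_def inner_axis)
    have x_sum: "(\<Sum>l\<in>UNIV. h l * x l) = h i - h j" for h :: "'n \<Rightarrow> real"
    proof -
      have "h l * x l = (if l = i then h l else 0) - (if l = j then h l else 0)" for l
        by (simp add: x_def)
      then show ?thesis
        by (simp add: sum_subtractf)
    qed
    \<comment> \<open>The assumption \<open>i \<noteq> j\<close> removes the cross term of the two
      indicators.\<close>
    have x_sq: "x l * x l = (if l = i then 1 else 0) + (if l = j then 1 else 0)" for l
      using that by (simp add: x_def)
    have yu: "y $ l *\<^sub>R u $ l = x l *\<^sub>R e" for l
      using pos[of l] by (simp add: u_def)
    have "(\<Sum>l\<in>UNIV. y $ l *\<^sub>R u $ l) = (\<Sum>l\<in>UNIV. 1 * x l) *\<^sub>R e"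
      by (simp add: yu scaleR_left.sum)
    then have "u \<in> E_space y"
      using x_sum[of "\<lambda>_. 1"] by (simp add: E_space_def)
    then have "(\<Sum>l\<in>UNIV. y $ l * (\<Sum>m\<in>UNIV. f l m * y $ m) * (norm (u $ l))\<^sup>2)
        - (\<Sum>l\<in>UNIV. \<Sum>m\<in>UNIV. f l m * y $ l * y $ m * (u $ l \<bullet> u $ m))
        = (\<Sum>l\<in>UNIV. y $ l * \<kappa> l * (norm (u $ l))\<^sup>2)"
      using diag friction_dissipation_expand[of f y u, OF sym]
      by (simp add: diagonal_form_on_E_def)
    then have "(\<Sum>l\<in>UNIV. y $ l * ((\<Sum>m\<in>UNIV. f l m * y $ m) - \<kappa> l) * (norm (u $ l))\<^sup>2)
        = (\<Sum>l\<in>UNIV. \<Sum>m\<in>UNIV. f l m * y $ l * y $ m * (u $ l \<bullet> u $ m))"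
      by (simp add: right_diff_distrib left_diff_distrib sum_subtractf)
    moreover have "y $ l * ((\<Sum>m\<in>UNIV. f l m * y $ m) - \<kappa> l) * (norm (u $ l))\<^sup>2
        = a l * (x l * x l)" for l
    proof -
      have "(norm (u $ l))\<^sup>2 = (x l / y $ l)\<^sup>2"
        using e by (simp only: u_def power2_norm_eq_inner vec_lambda_beta) (simp add: power2_eq_square)
      then show ?thesis
        using pos[of l] by (simp add: a_def power2_eq_square)
    qed
    moreover have "f l m * y $ l * y $ m * (u $ l \<bullet> u $ m) = f l m * x m * x l" for l m
      using pos[of l] pos[of m] e by (simp add: u_def field_simps)
    moreover have "(\<Sum>l\<in>UNIV. a l * (x l * x l)) = a i + a j"
      by (simp add: x_sq distrib_left sum.distrib if_distrib[of "(*) _"] cong: if_cong)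
    \<comment> \<open>\<open>x_sum\<close> is applied to the inner sum and then to the outer one,
      which evaluates the quadratic form of \<open>f\<close> at \<open>x\<close>.\<close>
    moreover have "(\<Sum>l\<in>UNIV. \<Sum>m\<in>UNIV. f l m * x m * x l) = (f i i - f i j) - (f j i - f j j)"
      by (simp add: x_sum flip: sum_distrib_right)
    ultimately have "a i + a j = (f i i - f i j) - (f j i - f j j)"
      by simp
    then show ?thesis
      using sym[OF that] by (simp add: field_simps)
  qed
  then have "additive_friction f (\<chi> i. (f i i - a i) / 2)"
    by (simp add: additive_friction_def)
  then show ?thesis ..
qed

text \<open>Needed for the step from (ii) to (i). With a single index the only candidate has entry
  1, which the strict upper bound excludes.\<close>

lemma open_simplex_nonempty:
  assumes "CARD('n::finite) \<ge> 2"
  shows "(open_simplex :: (real^'n) set) \<noteq> {}"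
proof -
  have "(\<chi> i. 1 / real CARD('n)) \<in> (open_simplex :: (real^'n) set)"
    using assms by (simp add: open_simplex_def)
  then show ?thesis by blast
qed

lemma additive_friction_recover:
  assumes "additive_friction f g" and "i \<noteq> j" "i \<noteq> k" "j \<noteq> k"
  shows "g $ i = 1/2 * (f i j + f i k - f j k)"
  using assms by (simp add: additive_friction_def)

text \<open>With three or more indices, every \<open>i\<close> belongs to a triple of distinct
  indices, and the recovery formula then expresses \<open>g $ i\<close> through \<open>f\<close>
  alone.\<close>

lemma additive_friction_unique:
  fixes f :: "'n::finite \<Rightarrow> 'n \<Rightarrow> real"
  assumes card: "CARD('n) \<ge> 3"
    and g: "additive_friction f g" and h: "additive_friction f h"
  shows "g = h"
proof -
  have "g $ i = h $ i" for i
  proof -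
    have "2 \<le> card (UNIV - {i})"
      using card by simp
    then obtain T where "T \<subseteq> UNIV - {i}" "card T = 2"
      by (meson obtain_subset_with_card_n)
    then obtain j k where "i \<noteq> j" "i \<noteq> k" "j \<noteq> k"
      by (auto simp: card_2_iff)
    then show ?thesis
      using additive_friction_recover[OF g, of i j k] additive_friction_recover[OF h, of i j k]
      by simp
  qed
  then show ?thesis
    by (simp add: vec_eq_iff)
qed

lemma linear_L_op:
  "linear (L_op g y :: ('a::real_normed_vector)^'n::finite \<Rightarrow> 'a^'n)"
proof (rule linearI)
  fix u v :: "'a^'n" and c :: real
  show "L_op g y (u + v) = L_op g y u + L_op g y v"
    by (simp add: L_op_def vec_eq_iff add_diff_add scaleR_add_right sum.distrib)
  show "L_op g y (c *\<^sub>R u) = c *\<^sub>R L_op g y u"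
    by (simp add: L_op_def vec_eq_iff scaleR_sum_right mult.commute flip: scaleR_diff_right)
qed

text \<open>Splitting the difference \<open>u $ i - u $ j\<close> leaves the row sum of the weights
  on \<open>u $ i\<close>. In the other part, the term with factor \<open>g $ i\<close> multiplies
  the weighted mean of \<open>u\<close>, which is 0 on \<open>E_space y\<close>.\<close>

lemma L_op_on_E:
  fixes u :: "(real^'d::finite)^'n::finite"
  assumes y: "y \<in> open_simplex" and u: "u \<in> E_space y"
  shows "L_op g y u $ i = (g $ i + (\<Sum>j\<in>UNIV. g $ j * y $ j)) *\<^sub>R (u $ i) - m_avg g y u"
proof -
  have "L_op g y u $ i = (\<Sum>j\<in>UNIV. (g $ i + g $ j) * y $ j) *\<^sub>R u $ i
      - (\<Sum>j\<in>UNIV. ((g $ i + g $ j) * y $ j) *\<^sub>R u $ j)"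
    by (simp add: L_op_def scaleR_diff_right sum_subtractf scaleR_left.sum)
  also have "(\<Sum>j\<in>UNIV. ((g $ i + g $ j) * y $ j) *\<^sub>R u $ j)
      = g $ i *\<^sub>R (\<Sum>j\<in>UNIV. y $ j *\<^sub>R u $ j) + m_avg g y u"
    by (simp add: m_avg_def distrib_right scaleR_add_left sum.distrib scaleR_sum_right)
  finally show ?thesis
    using u by (simp add: sum_additive_weights[OF y] E_space_def)
qed

text \<open>The vector \<open>m_avg g y u\<close> is the same for all indices, so it is paired with
  the weighted sum of \<open>u\<close>, which is 0. Only the diagonal form remains.\<close>

lemma friction_dissipation_eq_inner_L_op:
  fixes u :: "(real^'d::finite)^'n::finite"
  assumes g: "additive_friction f g" and y: "y \<in> open_simplex" and u: "u \<in> E_space y"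
  shows "friction_dissipation f y u = inner_y y (L_op g y u) u"
proof -
  define s where "s = (\<Sum>j\<in>UNIV. g $ j * y $ j)"
  have "inner_y y (L_op g y u) u
      = (\<Sum>i\<in>UNIV. y $ i * (g $ i + s) * (norm (u $ i))\<^sup>2 - m_avg g y u \<bullet> (y $ i *\<^sub>R u $ i))"
    by (simp add: inner_y_def L_op_on_E[OF y u] s_def inner_diff_left power2_norm_eq_inner
        right_diff_distrib mult.assoc)
  also have "\<dots> = (\<Sum>i\<in>UNIV. y $ i * (g $ i + s) * (norm (u $ i))\<^sup>2)
      - m_avg g y u \<bullet> (\<Sum>i\<in>UNIV. y $ i *\<^sub>R u $ i)"
    by (simp only: sum_subtractf inner_sum_right)
  finally show ?thesis
    using additive_imp_diagonal_form[OF g y, where 'd = 'd] u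
    by (simp add: diagonal_form_on_E_def E_space_def s_def)
qed

text \<open>Compared entrywise: multiplication by \<open>diag_matrix y\<close> scales columns on the
  right and rows on the left, so only the entries of the matrix of \<open>L_op g y\<close> are left
  to compute.\<close>

lemma MS_matrix_mult_diag:
  fixes f :: "'n::finite \<Rightarrow> 'n \<Rightarrow> real"
  assumes g: "additive_friction f g"
  shows "MS_matrix f y ** diag_matrix y
       = - (diag_matrix y ** matrix (L_op g y :: real^'n \<Rightarrow> real^'n))"
proof -
  have right: "(A ** diag_matrix y) $ i $ j = A $ i $ j * y $ j" for A :: "real^'n^'n" and i j
    by (simp add: matrix_matrix_mult_def diag_matrix_def if_distrib cong: if_cong)
  have left: "(diag_matrix y ** A) $ i $ j = y $ i * A $ i $ j" for A :: "real^'n^'n" and i j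
    by (simp add: matrix_matrix_mult_def diag_matrix_def if_distrib[of "\<lambda>t. t * _"] cong: if_cong)
  have "matrix (L_op g y :: real^'n \<Rightarrow> real^'n) $ i $ j
      = (if i = j then (\<Sum>l\<in>UNIV - {i}. f i l * y $ l) else - (f i j * y $ j))" for i j
  proof (cases "i = j")
    case True
    \<comment> \<open>Column \<open>i\<close> is the image of \<open>axis i 1\<close>. The
      difference of its entries vanishes at \<open>l = i\<close>, so the weight
      \<open>g $ i + g $ i\<close>, which need not equal \<open>f i i\<close>, drops out.\<close>
    have "matrix (L_op g y :: real^'n \<Rightarrow> real^'n) $ i $ i
        = (\<Sum>l\<in>UNIV. (g $ i + g $ l) * y $ l * (if l = i then 0 else 1))"
      by (auto simp: matrix_def L_op_def axis_def intro!: sum.cong)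
    also have "\<dots> = (\<Sum>l\<in>UNIV - {i}. f i l * y $ l)"
      using g by (intro sum.mono_neutral_cong_right) (auto simp: additive_friction_def)
    finally show ?thesis
      using True by simp
  next
    case False
    \<comment> \<open>For \<open>axis j 1\<close> with \<open>j \<noteq> i\<close>, entry
      \<open>i\<close> is 0, so only the summand \<open>l = j\<close> survives, with a minus
      sign.\<close>
    have "matrix (L_op g y :: real^'n \<Rightarrow> real^'n) $ i $ j
        = (\<Sum>l\<in>UNIV. if l = j then - ((g $ i + g $ l) * y $ l) else 0)"
      using False
      by (simp add: matrix_def L_op_def axis_def sum_negf if_distrib[of "(*) _"] cong: if_cong)
    with False g show ?thesis
      by (simp add: additive_friction_def)
  qed
  then show ?thesis
    by (simp add: vec_eq_iff right left MS_matrix_def)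
qed

theorem proposition2p7:
  fixes f :: "'n::finite \<Rightarrow> 'n \<Rightarrow> real"
  assumes "CARD('n) \<ge> 2"
    and "\<And>i j. i \<noteq> j \<Longrightarrow> f i j = f j i"
  shows
    "((\<exists>y\<in>open_simplex. \<exists>\<kappa>. diagonal_form_on_E TYPE('d::finite) f y \<kappa>)
        \<longleftrightarrow> (\<forall>y\<in>open_simplex. \<exists>\<kappa>. diagonal_form_on_E TYPE('d) f y \<kappa>))
     \<and> ((\<forall>y\<in>open_simplex. \<exists>\<kappa>. diagonal_form_on_E TYPE('d) f y \<kappa>)
        \<longleftrightarrow> (\<exists>g. additive_friction f g))
     \<and> (\<forall>g. additive_friction f g \<longrightarrow>
          (\<forall>y\<in>open_simplex.
             diagonal_form_on_E TYPE('d) f y (\<lambda>i. g $ i + (\<Sum>j\<in>UNIV. g $ j * y $ j))))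
     \<and> (CARD('n) \<ge> 3 \<longrightarrow> (\<exists>g. additive_friction f g) \<longrightarrow>
          (\<exists>!g. additive_friction f g)
          \<and> (\<forall>g. additive_friction f g \<longrightarrow>
               (\<forall>i j k. i \<noteq> j \<and> i \<noteq> k \<and> j \<noteq> k \<longrightarrow> g $ i = 1/2 * (f i j + f i k - f j k))))
     \<and> (\<forall>g. additive_friction f g \<longrightarrow>
          (\<forall>y\<in>open_simplex.
             linear (L_op g y :: (real^'d)^'n \<Rightarrow> (real^'d)^'n)
             \<and> (\<forall>u \<in> (E_space y :: ((real^'d)^'n) set).
                  (\<forall>i. L_op g y u $ i
                       = (g $ i + (\<Sum>j\<in>UNIV. g $ j * y $ j)) *\<^sub>R (u $ i) - m_avg g y u)
                  \<and> friction_dissipation f y u = inner_y y (L_op g y u) u)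
             \<and> linear (L_op g y :: real^'n \<Rightarrow> real^'n)
             \<and> MS_matrix f y ** diag_matrix y
                 = - (diag_matrix y ** matrix (L_op g y :: real^'n \<Rightarrow> real^'n))))"
proof -
  note sym = assms(2)
  \<comment> \<open>The equivalences follow from the cycle (i) to (iii) to (ii) to (i).\<close>
  have i_iii: "\<exists>g. additive_friction f g"
    if "\<exists>y\<in>open_simplex. \<exists>\<kappa>. diagonal_form_on_E TYPE('d) f y \<kappa>"
    using that diagonal_form_imp_additive[of f, OF sym] by blast
  have iii_ii: "\<forall>y\<in>open_simplex. \<exists>\<kappa>. diagonal_form_on_E TYPE('d) f y \<kappa>"
    if "\<exists>g. additive_friction f g"
    using that additive_imp_diagonal_form by blast
  have ii_i: "\<exists>y\<in>open_simplex. \<exists>\<kappa>. diagonal_form_on_E TYPE('d) f y \<kappa>"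
    if "\<forall>y\<in>open_simplex. \<exists>\<kappa>. diagonal_form_on_E TYPE('d) f y \<kappa>"
    using that open_simplex_nonempty[OF assms(1)] by blast
  show ?thesis
  proof (intro conjI allI impI ballI)
    show "(\<exists>y\<in>open_simplex. \<exists>\<kappa>. diagonal_form_on_E TYPE('d) f y \<kappa>)
        \<longleftrightarrow> (\<forall>y\<in>open_simplex. \<exists>\<kappa>. diagonal_form_on_E TYPE('d) f y \<kappa>)"
      using i_iii iii_ii ii_i by blast
    show "(\<forall>y\<in>open_simplex. \<exists>\<kappa>. diagonal_form_on_E TYPE('d) f y \<kappa>)
        \<longleftrightarrow> (\<exists>g. additive_friction f g)"
      using i_iii iii_ii ii_i by blast
    show "\<exists>!g. additive_friction f g" if "3 \<le> CARD('n)" "\<exists>g. additive_friction f g"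
      using that additive_friction_unique by blast
    show "g $ i = 1/2 * (f i j + f i k - f j k)"
      if "additive_friction f g" "i \<noteq> j \<and> i \<noteq> k \<and> j \<noteq> k" for g i j k
      using that additive_friction_recover by blast
  qed (auto intro: additive_imp_diagonal_form linear_L_op L_op_on_E
      friction_dissipation_eq_inner_L_op MS_matrix_mult_diag)
qed

end
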